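(* Consider the bilevel polynomial optimization problem (B) and Algorithm A, both described in the context, under the standing assumptions there, and suppose that the Lagrange multiplier assumption and the polynomial extension assumption hold. If Algorithm A terminates at the loop $k$ (i.e. it stops in Step 2 of loop $k$ because $\upsilon_k^*=0$), then the point $(x^{(k)},y^{(k)})$ is a global optimizer of (B).
   Context: **Problem.** Let $\mathcal{E}_1,\mathcal{I}_1$ be disjoint finite index sets and let $\mathcal{E}_2,\mathcal{I}_2$ be disjoint finite index sets with $\mathcal{E}_2\cup\mathcal{I}_2=\{1,\dots,m_2\}$ (any of them may be empty). Let $F(x,y)$, $h_i(x,y)$ ($i\in\mathcal{E}_1\cup\mathcal{I}_1$), $f(x,z)$, $g_j(x,z)$ ($j\in\mathcal{E}_2\cup\mathcal{I}_2$) be real polynomials, with $x\in\mathbb{R}^n$ and $y,z\in\mathbb{R}^p$. Set $$Z(x)=\{z\in\mathbb{R}^p: g_i(x,z)=0\ (i\in\mathcal{E}_2),\ g_j(x,z)\ge0\ (j\in\mathcal{I}_2)\}.$$ For given $x$, the lower level problem $(P_x)$ is to minimize $f(x,z)$ over $z\in Z(x)$; $S(x)$ is its set of global minimizers. The bilevel problem (B) is $$F^*=\min_{x\in\mathbb{R}^n,\,y\in\mathbb{R}^p}F(x,y)\quad\text{s.t. } h_i(x,y)=0\ (i\in\mathcal{E}_1),\ h_j(x,y)\ge0\ (j\in\mathcal{I}_1),\ y\in S(x).$$ Let $$\mathcal{U}=\{(x,y): h_i(x,y)=0\ (i\in\mathcal{E}_1),\ h_j(x,y)\ge0\ (j\in\mathcal{I}_1),\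 y\in Z(x)\}.$$ Call $x$ feasible if $(x,y)\in\mathcal{U}$ for some $y$. **KKT points.** A pair $(x,y)$ with $y\in Z(x)$ is a KKT point (of the lower level problem) if there is $\lambda\in\mathbb{R}^{m_2}$ with $\nabla_z f(x,y)=\sum_{j=1}^{m_2}\lambda_j\nabla_z g_j(x,y)$, $\lambda_jg_j(x,y)=0$ for all $j$, and $\lambda_j\ge0$ for $j\in\mathcal{I}_2$. Here $\nabla_z$ is the gradient in the second argument, evaluated at $z=y$. **Lagrange multiplier assumption.** There are nonzero polynomials $d_1(x,y),\dots,d_{m_2}(x,y)$, nonnegative on $\mathcal{U}$, and not identically zero polynomials $\phi_1(x,y),\dots,\phi_{m_2}(x,y)$ such that $\lambda_jd_j(x,y)=\phi_j(x,y)$, $j=1,\dots,m_2$, for all KKT points $(x,y)$ and associated multipliers $\lambda$. Let $D$ be the least common multiple of $d_1,\dots,d_{m_2}$, let $D_j=D/d_j$, and let $\mathcal{K}$ be the set of $(x,y)$ satisfying $$D\nabla_zf(x,y)-\sum_{j=1}^{m_2}D_j\phi_j\nabla_zg_j(x,y)=0,\qquad \phi_j(x,y)\ge0,\ \phi_j(x,y)g_j(x,y)=0\ (j\in\mathcal{I}_2)$$ ($D,D_j,\phi_j$ evaluated at $(x,y)$). **Standing assumptions.** For every feasible $x$: $S(x)\neq\emptyset$, and for every $y\in S(x)$ the pair $(x,y)$ is a KKT point. All KKT points are contained in $\mathcal{K}$. **Polynomial extension assumption.** For every $(\hat x,\hat y)\in\mathcal{U}\cap\mathcal{K}$ and every $\hat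 z\in S(\hat x)$ there is a tuple of polynomials $q(x,y)=(q_1(x,y),\dots,q_p(x,y))$ with $q(\hat x,\hat y)=\hat z$ and $q(x,y)\in Z(x)$ for all $(x,y)\in\mathcal{U}$. Such a $q$ is called a polynomial extension of $\hat z$ at $(\hat x,\hat y)$. **Algorithm A.** All subproblems are solved exactly (globally). - Step 0: Let $\mathcal{U}_0=\mathcal{U}\cap\mathcal{K}$ and $k=0$. - Step 1: Solve $(P_k)$: $F_k^*=\min F(x,y)$ s.t. $(x,y)\in\mathcal{U}_k$. If infeasible, stop without output. Otherwise let $(x^{(k)},y^{(k)})$ be a global minimizer. - Step 2: Solve $(Q_k)$: $\upsilon_k^*=\min_z f(x^{(k)},z)-f(x^{(k)},y^{(k)})$ s.t. $z\in Z(x^{(k)})$, $(x^{(k)},z)\in\mathcal{K}$, and let $z^{(k)}$ be a global minimizer. If $\upsilon_k^*=0$, stop and output $(x^{(k)},y^{(k)})$. - Step 3: Otherwise choose a polynomial extension $q^{(k)}$ of $z^{(k)}$ at $(x^{(k)},y^{(k)})$, i.e. a polynomial tuple with $q^{(k)}(x^{(k)},y^{(k)})=z^{(k)}$ and $q^{(k)}(x,y)\in Z(x)$ for all $(x,y)\in\mathcal{U}$. Set $\mathcal{U}_{k+1}=\{(x,y)\in\mathcal{U}_k: f(x,q^{(k)}(x,y))-f(x,y)\ge0\}$, replace $k$ by $k+1$, and go to Step 1. *)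

theory Defs
  imports "HOL-Analysis.Analysis"
begin

text \<open>
  Real polynomials in \<open>(x,y)\<close> are represented by the functions they induce on
  \<open>\<real>\<^sup>n \<times> \<real>\<^sup>p\<close>, using \<^const>\<open>real_polynomial_function\<close>. As \<open>\<real>\<close> is infinite, the ring
  of polynomial functions is isomorphic to the polynomial ring, so that being nonzero,
  divisibility and least common multiples have their usual meaning.
\<close>

record ('i, 'n::finite, 'p::finite) bilevel =
  uobj :: "(real^'n) \<times> (real^'p) \<Rightarrow> real"         (* F *)
  ucon :: "'i \<Rightarrow> (real^'n) \<times> (real^'p) \<Rightarrow> real"   (* h *)
  ueq :: "'i set"                               (* E_1 *)
  uineq :: "'i set"                             (* I_1 *)
  lobj :: "(real^'n) \<times> (real^'p) \<Rightarrow> real"         (* f *)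
  lcon :: "nat \<Rightarrow> (real^'n) \<times> (real^'p) \<Rightarrow> real"  (* g *)
  leq :: "nat set"                              (* E_2 *)
  lineq :: "nat set"                            (* I_2 *)
  lnum :: nat                                   (* m_2 *)

definition bilevel_polynomial :: "('i, 'n::finite, 'p::finite) bilevel \<Rightarrow> bool" where
  "bilevel_polynomial P \<longleftrightarrow>
     finite (ueq P) \<and> finite (uineq P) \<and> ueq P \<inter> uineq P = {} \<and>
     leq P \<union> lineq P = {1..lnum P} \<and> leq P \<inter> lineq P = {} \<and>
     real_polynomial_function (uobj P) \<and> real_polynomial_function (lobj P) \<and>
     (\<forall>i \<in> ueq P \<union> uineq P. real_polynomial_function (ucon P i)) \<and>
     (\<forall>j \<in> leq P \<union> lineq P. real_polynomial_function (lcon P j))"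

definition Zset :: "('i, 'n::finite, 'p::finite) bilevel \<Rightarrow> real^'n \<Rightarrow> (real^'p) set" where
  "Zset P x = {z. (\<forall>i \<in> leq P. lcon P i (x, z) = 0) \<and> (\<forall>j \<in> lineq P. lcon P j (x, z) \<ge> 0)}"

definition Sset :: "('i, 'n::finite, 'p::finite) bilevel \<Rightarrow> real^'n \<Rightarrow> (real^'p) set" where
  "Sset P x = {z. is_arg_min (\<lambda>z. lobj P (x, z)) (\<lambda>z. z \<in> Zset P x) z}"

definition upper_feasible :: "('i, 'n::finite, 'p::finite) bilevel \<Rightarrow> ((real^'n) \<times> (real^'p)) set" where
  "upper_feasible P = {v. (\<forall>i \<in> ueq P. ucon P i v = 0) \<and> (\<forall>j \<in> uineq P. ucon P j v \<ge> 0)}"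

definition Uset :: "('i, 'n::finite, 'p::finite) bilevel \<Rightarrow> ((real^'n) \<times> (real^'p)) set" where
  "Uset P = {(x, y). (x, y) \<in> upper_feasible P \<and> y \<in> Zset P x}"

definition feasible :: "('i, 'n::finite, 'p::finite) bilevel \<Rightarrow> real^'n \<Rightarrow> bool" where
  "feasible P x \<longleftrightarrow> (\<exists>y. (x, y) \<in> Uset P)"

definition global_optimizer :: "('i, 'n::finite, 'p::finite) bilevel \<Rightarrow> (real^'n) \<times> (real^'p) \<Rightarrow> bool" where
  "global_optimizer P v \<longleftrightarrow>
     is_arg_min (uobj P) (\<lambda>(x, y). (x, y) \<in> upper_feasible P \<and> y \<in> Sset P x) v"

definition grad_z :: "((real^'n::finite) \<times> (real^'p::finite) \<Rightarrow> real) \<Rightarrow> real^'n \<Rightarrow> real^'p \<Rightarrow> real^'p" where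
  "grad_z \<psi> x y = (THE G. GDERIV (\<lambda>z. \<psi> (x, z)) y :> G)"

definition kkt_multiplier ::
    "('i, 'n::finite, 'p::finite) bilevel \<Rightarrow> real^'n \<Rightarrow> real^'p \<Rightarrow> (nat \<Rightarrow> real) \<Rightarrow> bool" where
  "kkt_multiplier P x y lam \<longleftrightarrow>
     grad_z (lobj P) x y = (\<Sum>j\<in>{1..lnum P}. lam j *\<^sub>R grad_z (lcon P j) x y) \<and>
     (\<forall>j\<in>{1..lnum P}. lam j * lcon P j (x, y) = 0) \<and>
     (\<forall>j \<in> lineq P. lam j \<ge> 0)"

definition kkt_point :: "('i, 'n::finite, 'p::finite) bilevel \<Rightarrow> real^'n \<Rightarrow> real^'p \<Rightarrow> bool" where
  "kkt_point P x y \<longleftrightarrow> y \<in> Zset P x \<and> (\<exists>lam. kkt_multiplier P x y lam)"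

definition multiplier_assumption ::
    "('i, 'n::finite, 'p::finite) bilevel \<Rightarrow> (nat \<Rightarrow> (real^'n) \<times> (real^'p) \<Rightarrow> real) \<Rightarrow>
     (nat \<Rightarrow> (real^'n) \<times> (real^'p) \<Rightarrow> real) \<Rightarrow> bool" where
  "multiplier_assumption P d \<phi> \<longleftrightarrow>
     (\<forall>j\<in>{1..lnum P}.
        real_polynomial_function (d j) \<and> d j \<noteq> (\<lambda>v. 0) \<and> (\<forall>v \<in> Uset P. d j v \<ge> 0) \<and>
        real_polynomial_function (\<phi> j) \<and> \<phi> j \<noteq> (\<lambda>v. 0)) \<and>
     (\<forall>x y lam. kkt_point P x y \<and> kkt_multiplier P x y lam \<longrightarrow>
        (\<forall>j\<in>{1..lnum P}. lam j * d j (x, y) = \<phi> j (x, y)))"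

definition poly_dvd :: "('a::real_normed_vector \<Rightarrow> real) \<Rightarrow> ('a \<Rightarrow> real) \<Rightarrow> bool" where
  "poly_dvd a b \<longleftrightarrow> (\<exists>c. real_polynomial_function c \<and> b = (\<lambda>v. a v * c v))"

text \<open>
  A least common multiple is determined up to a nonzero constant factor, which does not
  affect the set \<open>\<K>\<close> below. For an empty index set it is a nonzero constant.
\<close>

definition is_poly_lcm :: "('a::real_normed_vector \<Rightarrow> real) \<Rightarrow> (nat \<Rightarrow> 'a \<Rightarrow> real) \<Rightarrow> nat set \<Rightarrow> bool" where
  "is_poly_lcm D d J \<longleftrightarrow>
     real_polynomial_function D \<and> (\<forall>j\<in>J. poly_dvd (d j) D) \<and>
     (\<forall>M. real_polynomial_function M \<and> (\<forall>j\<in>J. poly_dvd (d j) M) \<longrightarrow> poly_dvd D M)"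

text \<open>
  The quotient has to be taken in the ring of polynomials: the pointwise quotient of values
  would be \<open>0\<close> at the zeros of the divisor.
\<close>

definition poly_quot :: "('a::real_normed_vector \<Rightarrow> real) \<Rightarrow> ('a \<Rightarrow> real) \<Rightarrow> 'a \<Rightarrow> real" where
  "poly_quot D a = (THE c. real_polynomial_function c \<and> D = (\<lambda>v. a v * c v))"

definition Kset ::
    "('i, 'n::finite, 'p::finite) bilevel \<Rightarrow> (nat \<Rightarrow> (real^'n) \<times> (real^'p) \<Rightarrow> real) \<Rightarrow>
     (nat \<Rightarrow> (real^'n) \<times> (real^'p) \<Rightarrow> real) \<Rightarrow> ((real^'n) \<times> (real^'p) \<Rightarrow> real) \<Rightarrow>
     ((real^'n) \<times> (real^'p)) set" where
  "Kset P d \<phi> D = {(x, y).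
     D (x, y) *\<^sub>R grad_z (lobj P) x y
       - (\<Sum>j\<in>{1..lnum P}. (poly_quot D (d j) (x, y) * \<phi> j (x, y)) *\<^sub>R grad_z (lcon P j) x y) = 0 \<and>
     (\<forall>j \<in> lineq P. \<phi> j (x, y) \<ge> 0 \<and> \<phi> j (x, y) * lcon P j (x, y) = 0)}"

definition standing_assumptions ::
    "('i, 'n::finite, 'p::finite) bilevel \<Rightarrow> ((real^'n) \<times> (real^'p)) set \<Rightarrow> bool" where
  "standing_assumptions P K \<longleftrightarrow>
     (\<forall>x. feasible P x \<longrightarrow> Sset P x \<noteq> {} \<and> (\<forall>y \<in> Sset P x. kkt_point P x y)) \<and>
     (\<forall>x y. kkt_point P x y \<longrightarrow> (x, y) \<in> K)"

definition polynomial_extension ::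
    "('i, 'n::finite, 'p::finite) bilevel \<Rightarrow> ((real^'n) \<times> (real^'p) \<Rightarrow> real^'p) \<Rightarrow>
     (real^'n) \<times> (real^'p) \<Rightarrow> real^'p \<Rightarrow> bool" where
  "polynomial_extension P q v z \<longleftrightarrow>
     (\<forall>i. real_polynomial_function (\<lambda>w. q w $ i)) \<and> q v = z \<and>
     (\<forall>(x, y) \<in> Uset P. q (x, y) \<in> Zset P x)"

definition extension_assumption ::
    "('i, 'n::finite, 'p::finite) bilevel \<Rightarrow> ((real^'n) \<times> (real^'p)) set \<Rightarrow> bool" where
  "extension_assumption P K \<longleftrightarrow>
     (\<forall>(x, y) \<in> Uset P \<inter> K. \<forall>z \<in> Sset P x. \<exists>q. polynomial_extension P q (x, y) z)"

definition solves_Pk ::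
    "('i, 'n::finite, 'p::finite) bilevel \<Rightarrow> ((real^'n) \<times> (real^'p)) set \<Rightarrow>
     (real^'n) \<times> (real^'p) \<Rightarrow> bool" where
  "solves_Pk P W v \<longleftrightarrow> is_arg_min (uobj P) (\<lambda>v. v \<in> W) v"

definition solves_Qk ::
    "('i, 'n::finite, 'p::finite) bilevel \<Rightarrow> ((real^'n) \<times> (real^'p)) set \<Rightarrow>
     real^'n \<Rightarrow> real^'p \<Rightarrow> real^'p \<Rightarrow> real \<Rightarrow> bool" where
  "solves_Qk P K x y z \<upsilon> \<longleftrightarrow>
     is_arg_min (\<lambda>z. lobj P (x, z) - lobj P (x, y)) (\<lambda>z. z \<in> Zset P x \<and> (x, z) \<in> K) z \<and>
     \<upsilon> = lobj P (x, z) - lobj P (x, y)"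

text \<open>
  The algorithm is nondeterministic in its choice of minimizers and extensions.
  \<open>algA_loop P K k W\<close>: some run reaches Step 1 of loop \<open>k\<close> with \<open>\<U>\<^sub>k = W\<close>.
  \<open>algA_output P K k v\<close>: some run stops in Step 2 of loop \<open>k\<close> with output \<open>v\<close>.
\<close>

inductive algA_loop ::
    "('i, 'n::finite, 'p::finite) bilevel \<Rightarrow> ((real^'n) \<times> (real^'p)) set \<Rightarrow>
     nat \<Rightarrow> ((real^'n) \<times> (real^'p)) set \<Rightarrow> bool"
  for P :: "('i, 'n::finite, 'p::finite) bilevel" and K :: "((real^'n) \<times> (real^'p)) set" where
  start: "algA_loop P K 0 (Uset P \<inter> K)"
| step: "algA_loop P K k W \<Longrightarrow> solves_Pk P W (x, y) \<Longrightarrow> solves_Qk P K x y z \<upsilon> \<Longrightarrow> \<upsilon> \<noteq> 0 \<Longrightarrow>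
    polynomial_extension P q (x, y) z \<Longrightarrow>
    algA_loop P K (Suc k) {(x', y') \<in> W. lobj P (x', q (x', y')) - lobj P (x', y') \<ge> 0}"

definition algA_output ::
    "('i, 'n::finite, 'p::finite) bilevel \<Rightarrow> ((real^'n) \<times> (real^'p)) set \<Rightarrow>
     nat \<Rightarrow> (real^'n) \<times> (real^'p) \<Rightarrow> bool" where
  "algA_output P K k v \<longleftrightarrow>
     (\<exists>W x y z \<upsilon>. algA_loop P K k W \<and> solves_Pk P W (x, y) \<and> solves_Qk P K x y z \<upsilon> \<and> \<upsilon> = 0 \<and> v = (x, y))"

end

theory Submission
  imports Defs
begin

text \<open>
  Every loop of the algorithm minimizes \<open>F\<close> over a relaxation of the bilevel problem. A point
  \<open>(x,y)\<close> with \<open>y \<in> S(x)\<close> is a KKT point, so it lies in \<open>\<K>\<close>, and no cut removes it: an extension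
  \<open>q\<close> satisfies \<open>q(x,y) \<in> Z(x)\<close>, so \<open>f(x,q(x,y)) \<ge> f(x,y)\<close> by the optimality of \<open>y\<close>. This is
  \<open>bilevel_feasible_in_algA_loop\<close>. Conversely, restricting the lower level problem to \<open>\<K>\<close> does
  not change its optimal value at a feasible \<open>x\<close>, because \<open>S(x)\<close> is nonempty and all of its points
  survive the restriction. So an optimal value \<open>0\<close> of \<open>(Q\<^sub>k)\<close> certifies \<open>y\<^sup>k \<in> S(x\<^sup>k)\<close>
  (\<open>lower_optimal_if_Qk_value_0\<close>). The output is therefore a minimizer over a relaxation that is
  feasible for the original problem, and hence a minimizer of the original problem.
\<close>

lemma mem_Sset_iff:
  "z \<in> Sset P x \<longleftrightarrow> z \<in> Zset P x \<and> (\<forall>w \<in> Zset P x. lobj P (x, z) \<le> lobj P (x, w))"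
  by (auto simp: Sset_def is_arg_min_linorder)

lemma Sset_in_K:
  assumes "standing_assumptions P K" "feasible P x" "y \<in> Sset P x"
  shows "(x, y) \<in> K"
  using assms by (auto simp: standing_assumptions_def)

lemma algA_loop_subset:
  assumes "algA_loop P K k W"
  shows "W \<subseteq> Uset P \<inter> K"
  using assms by induction auto

text \<open>
  The cuts only remove points whose second component is not a global minimizer of the lower level
  problem: the value of an extension is a competitor in \<open>Z(x)\<close>, which cannot beat a minimizer.
\<close>

lemma bilevel_feasible_in_algA_loop:
  assumes loop: "algA_loop P K k W" and SA: "standing_assumptions P K"
    and up: "(x, y) \<in> upper_feasible P" and y: "y \<in> Sset P x"
  shows "(x, y) \<in> W"
proof -
  have U: "(x, y) \<in> Uset P"
    using up y by (simp add: Uset_def mem_Sset_iff)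
  show ?thesis
    using loop
  proof induction
    case start
    have "feasible P x"
      using U by (auto simp: feasible_def)
    then show ?case
      using U Sset_in_K[OF SA _ y] by simp
  next
    case (step k W x' y' z \<upsilon> q)
    have "q (x, y) \<in> Zset P x"
      using step.hyps U by (auto simp: polynomial_extension_def)
    then have "lobj P (x, y) \<le> lobj P (x, q (x, y))"
      using y by (simp add: mem_Sset_iff)
    then show ?case
      using step.IH by simp
  qed
qed

text \<open>
  A true lower level minimizer \<open>s\<close> is itself admissible in \<open>(Q\<^sub>k)\<close>, so the minimizer \<open>z\<close> over the
  restricted set is as good as \<open>s\<close>; the value \<open>0\<close> says that \<open>y\<close> is as good as \<open>z\<close>.
\<close>

lemma lower_optimal_if_Qk_value_0:
  assumes SA: "standing_assumptions P K" and U: "(x, y) \<in> Uset P"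
    and Q: "solves_Qk P K x y z 0"
  shows "y \<in> Sset P x"
proof -
  have feas: "feasible P x"
    using U by (auto simp: feasible_def)
  then obtain s where s: "s \<in> Sset P x"
    using SA unfolding standing_assumptions_def by blast
  have "lobj P (x, y) = lobj P (x, z)"
    using Q by (simp add: solves_Qk_def)
  also have "\<dots> \<le> lobj P (x, s)"
    using Q s Sset_in_K[OF SA feas s]
    by (auto simp: solves_Qk_def is_arg_min_linorder mem_Sset_iff)
  finally have "lobj P (x, y) \<le> lobj P (x, s)" .
  moreover have "y \<in> Zset P x"
    using U by (simp add: Uset_def)
  ultimately show ?thesis
    using s by (force simp: mem_Sset_iff)
qed

theorem proposition3p5:
  fixes P :: "('i, 'n::finite, 'p::finite) bilevel"
    and d \<phi> :: "nat \<Rightarrow> (real^'n) \<times> (real^'p) \<Rightarrow> real"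
    and D :: "(real^'n) \<times> (real^'p) \<Rightarrow> real"
    and K :: "((real^'n) \<times> (real^'p)) set"
    and k :: nat and xk :: "real^'n" and yk :: "real^'p"
  assumes "bilevel_polynomial P"
    and "multiplier_assumption P d \<phi>"
    and "is_poly_lcm D d {1..lnum P}"
    and "K = Kset P d \<phi> D"
    and "standing_assumptions P K"
    and "extension_assumption P K"
    and "algA_output P K k (xk, yk)"
  shows "global_optimizer P (xk, yk)"
proof -
  note SA = \<open>standing_assumptions P K\<close>
  obtain W z where loop: "algA_loop P K k W" and Pk: "solves_Pk P W (xk, yk)"
    and Qk: "solves_Qk P K xk yk z 0"
    using \<open>algA_output P K k (xk, yk)\<close> by (auto simp: algA_output_def)
  have "(xk, yk) \<in> W" and min: "\<And>v. v \<in> W \<Longrightarrow> uobj P (xk, yk) \<le> uobj P v"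
    using Pk by (auto simp: solves_Pk_def is_arg_min_linorder)
  then have U: "(xk, yk) \<in> Uset P"
    using algA_loop_subset[OF loop] by blast
  have "yk \<in> Sset P xk"
    using lower_optimal_if_Qk_value_0[OF SA U Qk] .
  moreover have "(xk, yk) \<in> upper_feasible P"
    using U by (simp add: Uset_def)
  ultimately show ?thesis
    using min bilevel_feasible_in_algA_loop[OF loop SA]
    by (auto simp: global_optimizer_def is_arg_min_linorder)
qed

end
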